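(* Let $n\ge1$, $\sigma\in S_n$ and let $\alpha$ be a weak composition of length $n$. Then $$\mathcal{A}_\alpha^\sigma(x_1,\dots,x_n)=\sum_{\beta_{(n)}\lessdot_\sigma\cdots\lessdot_\sigma\beta_{(1)}\lessdot_\sigma\alpha}x_1^{|\alpha|-|\beta_{(1)}|}\,x_2^{|\beta_{(1)}|-|\beta_{(2)}|}\cdots x_n^{|\beta_{(n-1)}|-|\beta_{(n)}|},$$ where the sum is over all (saturated) chains $\beta_{(n)}\lessdot_\sigma\cdots\lessdot_\sigma\beta_{(1)}\lessdot_\sigma\alpha$ of weak compositions (so $\beta_{(i)}$ has length $n-i$ and $\beta_{(n)}$ is the empty composition).
   Context: $[n]=\{1,\dots,n\}$. A weak composition is a finite sequence of nonnegative integers; $\operatorname{len}$ is its length and $|\alpha|$ the sum of its parts. **Atoms.** A semi-skyline augmented filling (SSAF) of shape $\alpha$ with basement $\sigma$ is a function $F:\{(i,j): i\in[n],\,0\le j\le\alpha_i\}\to\mathbb{Z}_{>0}$ (elements of the domain are cells) such that: (i) $F(i,0)=\sigma(i)$ for all $i$ (cells $(i,0)$ form the basement); (ii) $F(i,j+1)\le F(i,j)$ whenever both cells exist; (iii) every triple is an inversion triple. Triples: let $1\le\ell<r\le n$. If $\alpha_\ell\ge\alpha_r$, a type A triple is $\{(\ell,i+1),(r,i+1),(\ell,i)\}$, $i\ge0$ (all cells in the domain), with entries $a=F(\ell,i+1)$, $b=F(r,i+1)$, $c=F(\ell,i)$. If $\alpha_\ell<\alpha_r$, a type B triple is $\{(r,i+1),(\ell,i),(r,i)\}$,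 $i\ge 0$ (all cells in the domain), with $a=F(r,i+1)$, $b=F(\ell,i)$, $c=F(r,i)$. A triple is an inversion triple if $b\notin[a,c]$. Then $\mathcal{A}_\alpha^\sigma(x)=\sum_F x^F$, summed over all SSAFs $F$ of shape $\alpha$ with basement $\sigma$, where $x^F$ is the product of $x_{F(c)}$ over all non-basement cells $c$. **$\sigma$-extendability.** For weak compositions $\alpha,\beta$ of length $m$ and $\tau\in S_m$, $\beta$ is $\tau$-extendable to $\alpha$ if $\alpha_i\ge\beta_i$ for all $i$ and for all $1\le\ell<r\le m$: (1) if $\alpha_\ell\ge\alpha_r$ and $\beta_\ell\ge\beta_r$ then $\alpha_r\le\beta_\ell$; (2) if $\alpha_\ell<\alpha_r$ and $\beta_\ell<\beta_r$ then $\alpha_\ell<\beta_r$; (3) if $\alpha_\ell\ge\alpha_r$ and $\beta_\ell<\beta_r$ then $\alpha_r=\beta_r$ and $\tau(\ell)<\tau(r)$; (4) if $\alpha_\ell<\alpha_r$ and $\beta_\ell\ge\beta_r$ then $\alpha_\ell=\beta_\ell$ and $\tau(\ell)>\tau(r)$. **Covering relation.** Set $\sigma_0=\sigma$, and let $\sigma_{i+1}$ be obtained from $\sigma_i$ (in one-line notation) by deleting the entry $1$ and subtracting $1$ from all remaining entries; let $s_i=\sigma_i^{-1}(1)$. If $\operatorname{len}(\beta)=\ell<n$ and $\operatorname{len}(\alpha)=\ell+1$, put $k=n-\ell-1$ and say $\beta\lessdot_\sigma\alpha$ if $(\beta_1,\dots,\beta_{s_k-1},0,\beta_{s_k},\dots,\beta_\ell)$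 is $\sigma_k$-extendable to $\alpha$. (The relation $\lessdot_\sigma$ is the covering relation of its reflexive transitive closure $\le_\sigma$, a poset ranked by length.) *)

theory Defs
  imports "HOL-Combinatorics.Permutations" "HOL-Library.FuncSet" "HOL-Library.Poly_Mapping"
begin

text \<open>
  Weak compositions are lists of natural numbers. A permutation in \<open>S\<^sub>n\<close> is a
  function on \<open>nat\<close> that permutes \<open>{1..n}\<close>. All indices are 1-based, as in the
  mathematical text; \<open>part \<alpha> i\<close> is the \<open>i\<close>-th part of \<open>\<alpha>\<close>, for \<open>1 \<le> i \<le> length \<alpha>\<close>.
\<close>

definition part :: "nat list \<Rightarrow> nat \<Rightarrow> nat" where
  "part \<alpha> i = \<alpha> ! (i - 1)"


subsection \<open>Integer polynomials in countably many variables\<close>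

type_synonym mpoly = "(nat \<Rightarrow>\<^sub>0 nat) \<Rightarrow>\<^sub>0 int"

definition X :: "nat \<Rightarrow> mpoly" where
  "X i = Poly_Mapping.single (Poly_Mapping.single i 1) 1"


subsection \<open>Atoms\<close>

definition cells :: "nat list \<Rightarrow> (nat \<times> nat) set" where
  "cells \<alpha> = {(i, j). i \<in> {1..length \<alpha>} \<and> j \<le> part \<alpha> i}"

definition nonbasement_cells :: "nat list \<Rightarrow> (nat \<times> nat) set" where
  "nonbasement_cells \<alpha> = {(i, j) \<in> cells \<alpha>. j \<noteq> 0}"

definition inversion_triple :: "nat \<Rightarrow> nat \<Rightarrow> nat \<Rightarrow> bool" where
  "inversion_triple a b c \<longleftrightarrow> b \<notin> {a..c}"

definition type_A_inversions :: "nat list \<Rightarrow> (nat \<times> nat \<Rightarrow> nat) \<Rightarrow> bool" where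
  "type_A_inversions \<alpha> F \<longleftrightarrow>
     (\<forall>l r i. 1 \<le> l \<and> l < r \<and> r \<le> length \<alpha> \<and> part \<alpha> l \<ge> part \<alpha> r \<and>
        {(l, i + 1), (r, i + 1), (l, i)} \<subseteq> cells \<alpha> \<longrightarrow>
        inversion_triple (F (l, i + 1)) (F (r, i + 1)) (F (l, i)))"

definition type_B_inversions :: "nat list \<Rightarrow> (nat \<times> nat \<Rightarrow> nat) \<Rightarrow> bool" where
  "type_B_inversions \<alpha> F \<longleftrightarrow>
     (\<forall>l r i. 1 \<le> l \<and> l < r \<and> r \<le> length \<alpha> \<and> part \<alpha> l < part \<alpha> r \<and>
        {(r, i + 1), (l, i), (r, i)} \<subseteq> cells \<alpha> \<longrightarrow>
        inversion_triple (F (r, i + 1)) (F (l, i)) (F (r, i)))"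

text \<open>
  Fillings are extensional (\<open>undefined\<close> off the cells), so that distinct elements
  of \<open>SSAF \<sigma> \<alpha>\<close> are distinct fillings of the diagram.
\<close>

definition SSAF :: "(nat \<Rightarrow> nat) \<Rightarrow> nat list \<Rightarrow> (nat \<times> nat \<Rightarrow> nat) set" where
  "SSAF \<sigma> \<alpha> = {F \<in> cells \<alpha> \<rightarrow>\<^sub>E {0<..}.
     (\<forall>i\<in>{1..length \<alpha>}. F (i, 0) = \<sigma> i) \<and>
     (\<forall>i j. (i, j) \<in> cells \<alpha> \<and> (i, j + 1) \<in> cells \<alpha> \<longrightarrow> F (i, j + 1) \<le> F (i, j)) \<and>
     type_A_inversions \<alpha> F \<and> type_B_inversions \<alpha> F}"

definition atom :: "(nat \<Rightarrow> nat) \<Rightarrow> nat list \<Rightarrow> mpoly" where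
  "atom \<sigma> \<alpha> = (\<Sum>F\<in>SSAF \<sigma> \<alpha>. \<Prod>c\<in>nonbasement_cells \<alpha>. X (F c))"


subsection \<open>Extendability\<close>

definition extendable :: "(nat \<Rightarrow> nat) \<Rightarrow> nat list \<Rightarrow> nat list \<Rightarrow> bool" where
  "extendable \<tau> \<beta> \<alpha> \<longleftrightarrow>
     length \<beta> = length \<alpha> \<and>
     (\<forall>i\<in>{1..length \<alpha>}. part \<alpha> i \<ge> part \<beta> i) \<and>
     (\<forall>l r. 1 \<le> l \<and> l < r \<and> r \<le> length \<alpha> \<longrightarrow>
        (part \<alpha> l \<ge> part \<alpha> r \<and> part \<beta> l \<ge> part \<beta> r \<longrightarrow> part \<alpha> r \<le> part \<beta> l) \<and>
        (part \<alpha> l < part \<alpha> r \<and> part \<beta> l < part \<beta> r \<longrightarrow> part \<alpha> l < part \<beta> r) \<and>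
        (part \<alpha> l \<ge> part \<alpha> r \<and> part \<beta> l < part \<beta> r \<longrightarrow>
           part \<alpha> r = part \<beta> r \<and> \<tau> l < \<tau> r) \<and>
        (part \<alpha> l < part \<alpha> r \<and> part \<beta> l \<ge> part \<beta> r \<longrightarrow>
           part \<alpha> l = part \<beta> l \<and> \<tau> l > \<tau> r))"


subsection \<open>The covering relation\<close>

definition delete_one :: "nat list \<Rightarrow> nat list" where
  "delete_one w = map (\<lambda>x. x - 1) (filter (\<lambda>x. x \<noteq> 1) w)"

text \<open>
  \<open>reduced_word n \<sigma> k\<close> is the one-line notation of \<open>\<sigma>\<^sub>k \<in> S\<^bsub>n-k\<^esub>\<close>, and
  \<open>reduced_perm n \<sigma> k\<close> is \<open>\<sigma>\<^sub>k\<close> as a function, meaningful on \<open>{1..n - k}\<close> only.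
\<close>

definition reduced_word :: "nat \<Rightarrow> (nat \<Rightarrow> nat) \<Rightarrow> nat \<Rightarrow> nat list" where
  "reduced_word n \<sigma> k = (delete_one ^^ k) (map \<sigma> [1..<n + 1])"

definition reduced_perm :: "nat \<Rightarrow> (nat \<Rightarrow> nat) \<Rightarrow> nat \<Rightarrow> nat \<Rightarrow> nat" where
  "reduced_perm n \<sigma> k i = reduced_word n \<sigma> k ! (i - 1)"

definition pos_of_one :: "nat \<Rightarrow> (nat \<Rightarrow> nat) \<Rightarrow> nat \<Rightarrow> nat" where
  "pos_of_one n \<sigma> k = inv_into {1..n - k} (reduced_perm n \<sigma> k) 1"

definition insert_zero :: "nat \<Rightarrow> nat list \<Rightarrow> nat list" where
  "insert_zero s \<beta> = take (s - 1) \<beta> @ [0] @ drop (s - 1) \<beta>"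

definition covered_by :: "nat \<Rightarrow> (nat \<Rightarrow> nat) \<Rightarrow> nat list \<Rightarrow> nat list \<Rightarrow> bool" where
  "covered_by n \<sigma> \<beta> \<alpha> \<longleftrightarrow>
     length \<beta> < n \<and> length \<alpha> = length \<beta> + 1 \<and>
     (let k = n - length \<beta> - 1 in
        extendable (reduced_perm n \<sigma> k) (insert_zero (pos_of_one n \<sigma> k) \<beta>) \<alpha>)"

text \<open>
  A chain \<open>\<beta>\<^bsub>(n)\<^esub> \<lessdot> \<dots> \<lessdot> \<beta>\<^bsub>(1)\<^esub> \<lessdot> \<alpha>\<close> is the list \<open>[\<beta>\<^bsub>(1)\<^esub>, \<dots>, \<beta>\<^bsub>(n)\<^esub>]\<close>, so that
  \<open>chain_elem \<alpha> \<beta>s i\<close> is \<open>\<beta>\<^bsub>(i)\<^esub>\<close> under the convention \<open>\<beta>\<^bsub>(0)\<^esub> = \<alpha>\<close>.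
\<close>

definition chain_elem :: "nat list \<Rightarrow> nat list list \<Rightarrow> nat \<Rightarrow> nat list" where
  "chain_elem \<alpha> \<beta>s i = (\<alpha> # \<beta>s) ! i"

definition saturated_chains :: "nat \<Rightarrow> (nat \<Rightarrow> nat) \<Rightarrow> nat list \<Rightarrow> nat list list set" where
  "saturated_chains n \<sigma> \<alpha> = {\<beta>s. length \<beta>s = n \<and>
     (\<forall>i\<in>{1..n}. covered_by n \<sigma> (chain_elem \<alpha> \<beta>s i) (chain_elem \<alpha> \<beta>s (i - 1)))}"


subsection \<open>The index sets are finite and the exponents are not truncated\<close>

lemma finite_cells: "finite (cells \<alpha>)"
proof -
  have "cells \<alpha> = (SIGMA i:{1..length \<alpha>}. {..part \<alpha> i})"
    by (auto simp: cells_def)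
  then show ?thesis by simp
qed

lemma SSAF_entry_le:
  assumes "F \<in> SSAF \<sigma> \<alpha>" "(i, j) \<in> cells \<alpha>"
  shows "F (i, j) \<le> \<sigma> i"
  using assms(2)
proof (induction j)
  case 0
  then show ?case using assms(1) by (auto simp: SSAF_def cells_def)
next
  case (Suc j)
  then have "(i, j) \<in> cells \<alpha>" by (auto simp: cells_def)
  moreover from this Suc.prems have "F (i, Suc j) \<le> F (i, j)"
    using assms(1) by (auto simp: SSAF_def)
  ultimately show ?case using Suc.IH by simp
qed

lemma finite_SSAF: "finite (SSAF \<sigma> \<alpha>)"
proof (rule finite_subset)
  show "SSAF \<sigma> \<alpha> \<subseteq> (\<Pi>\<^sub>E c\<in>cells \<alpha>. {..\<sigma> (fst c)})"
  proof
    fix F assume F: "F \<in> SSAF \<sigma> \<alpha>"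
    then have "F \<in> extensional (cells \<alpha>)"
      by (auto simp: SSAF_def PiE_def)
    then show "F \<in> (\<Pi>\<^sub>E c\<in>cells \<alpha>. {..\<sigma> (fst c)})"
      using SSAF_entry_le[OF F] by (auto simp: PiE_def)
  qed
  show "finite (\<Pi>\<^sub>E c\<in>cells \<alpha>. {..\<sigma> (fst c)})"
    by (intro finite_PiE finite_cells) auto
qed

lemma extendable_sum_le: "extendable \<tau> \<beta> \<alpha> \<Longrightarrow> sum_list \<beta> \<le> sum_list \<alpha>"
proof -
  assume *: "extendable \<tau> \<beta> \<alpha>"
  have "\<beta> ! i \<le> \<alpha> ! i" if "i < length \<alpha>" for i
  proof -
    from that have "Suc i \<in> {1..length \<alpha>}" by simp
    with * have "part \<beta> (Suc i) \<le> part \<alpha> (Suc i)" unfolding extendable_def by blast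
    then show ?thesis by (simp add: part_def)
  qed
  with * show ?thesis
    by (auto simp: extendable_def sum_list_sum_nth atLeast0LessThan intro!: sum_mono)
qed

lemma covered_by_sum_le: "covered_by n \<sigma> \<beta> \<alpha> \<Longrightarrow> sum_list \<beta> \<le> sum_list \<alpha>"
proof -
  assume *: "covered_by n \<sigma> \<beta> \<alpha>"
  have "sum_list \<beta> = sum_list (take m \<beta>) + sum_list (drop m \<beta>)" for m
    by (metis append_take_drop_id sum_list_append)
  then have "sum_list (insert_zero s \<beta>) = sum_list \<beta>" for s
    by (simp add: insert_zero_def)
  with * show ?thesis
    unfolding covered_by_def Let_def by (metis extendable_sum_le)
qed

lemma saturated_chains_bounds:
  assumes "\<beta>s \<in> saturated_chains n \<sigma> \<alpha>" "i \<le> n"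
  shows "length (chain_elem \<alpha> \<beta>s i) + i = length \<alpha> \<and>
         sum_list (chain_elem \<alpha> \<beta>s i) \<le> sum_list \<alpha>"
  using assms(2)
proof (induction i)
  case 0
  then show ?case by (simp add: chain_elem_def)
next
  case (Suc i)
  then have "Suc i \<in> {1..n}" by simp
  with assms(1) have "covered_by n \<sigma> (chain_elem \<alpha> \<beta>s (Suc i)) (chain_elem \<alpha> \<beta>s i)"
    unfolding saturated_chains_def by (metis (mono_tags, lifting) diff_Suc_1 mem_Collect_eq)
  with Suc covered_by_sum_le[OF this] show ?case
    by (auto simp: covered_by_def)
qed

lemma finite_saturated_chains: "finite (saturated_chains n \<sigma> \<alpha>)"
proof -
  define B where "B = {\<beta>. set \<beta> \<subseteq> {..sum_list \<alpha>} \<and> length \<beta> \<le> length \<alpha>}"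
  have "finite B" unfolding B_def by (rule finite_lists_length_le) simp
  moreover have "saturated_chains n \<sigma> \<alpha> \<subseteq> {\<beta>s. set \<beta>s \<subseteq> B \<and> length \<beta>s = n}"
  proof (rule subsetI, rule CollectI, rule conjI)
    fix \<beta>s assume *: "\<beta>s \<in> saturated_chains n \<sigma> \<alpha>"
    show len: "length \<beta>s = n" using * by (simp add: saturated_chains_def)
    show "set \<beta>s \<subseteq> B"
    proof
      fix \<beta> assume "\<beta> \<in> set \<beta>s"
      then obtain i where "i < n" "\<beta> = \<beta>s ! i" using len by (metis in_set_conv_nth)
      then have "length \<beta> \<le> length \<alpha>" "sum_list \<beta> \<le> sum_list \<alpha>"
        using saturated_chains_bounds[OF *, of "Suc i"] by (auto simp: chain_elem_def)
      then show "\<beta> \<in> B" unfolding B_def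
        by (auto intro: order_trans[OF member_le_sum_list])
    qed
  qed
  ultimately show ?thesis
    using finite_subset finite_lists_length_eq by metis
qed

end

theory Submission
  imports Defs
begin

text \<open>
  In an SSAF of shape \<open>\<alpha>\<close> the column with basement entry \<open>1\<close> consists of ones only, and in each
  other column the ones sit on top. Let \<open>\<gamma>\<close> be the shape of the non-basement entries exceeding
  \<open>1\<close>. For each pair of columns, the triples of shape \<open>\<alpha>\<close> are all inversion triples iff those of
  shape \<open>\<gamma>\<close> are and \<open>\<gamma>\<close> is extendable to \<open>\<alpha>\<close> at this pair. Hence deleting all ones together with
  the column of the basement entry \<open>1\<close>, and lowering the remaining entries by \<open>1\<close>, is a bijection
  onto the pairs of some \<open>\<beta> \<lessdot> \<alpha>\<close> and an SSAF of shape \<open>\<beta>\<close>; it removes \<open>|\<alpha>| - |\<beta>|\<close> non-basement ones.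
  Iterating this gives the sum over chains.
\<close>

subsection \<open>Pairs of columns\<close>

text \<open>With \<open>a\<close> and \<open>b\<close> the heights of the left and the right column,
  the bounds on \<open>i\<close> single out the rows in which all three cells exist: type A needs
  \<open>Suc i \<le> b\<close>, and in type B \<open>i \<le> a\<close> already gives
  \<open>Suc i \<le> b\<close>.\<close>

definition triples_inverted :: "nat \<Rightarrow> nat \<Rightarrow> (nat \<Rightarrow> nat) \<Rightarrow> (nat \<Rightarrow> nat) \<Rightarrow> bool" where
  "triples_inverted a b f g \<longleftrightarrow>
     (if b \<le> a then \<forall>i<b. inversion_triple (f (Suc i)) (g (Suc i)) (f i)
      else \<forall>i\<le>a. inversion_triple (g (Suc i)) (f i) (g i))"

text \<open>The four clauses of extendability for one pair of columns, with heights
  \<open>a\<close>, \<open>b\<close> in the large shape, \<open>a'\<close>, \<open>b'\<close> in the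
  small one, and basement entries \<open>u\<close>, \<open>v\<close>.\<close>

definition heights_extend :: "nat \<Rightarrow> nat \<Rightarrow> nat \<Rightarrow> nat \<Rightarrow> nat \<Rightarrow> nat \<Rightarrow> bool" where
  "heights_extend a b a' b' u v \<longleftrightarrow>
     (b \<le> a \<and> b' \<le> a' \<longrightarrow> b \<le> a') \<and>
     (a < b \<and> a' < b' \<longrightarrow> a < b') \<and>
     (b \<le> a \<and> a' < b' \<longrightarrow> b = b' \<and> u < v) \<and>
     (a < b \<and> b' \<le> a' \<longrightarrow> a = a' \<and> v < u)"

definition column :: "nat \<Rightarrow> nat \<Rightarrow> (nat \<Rightarrow> nat) \<Rightarrow> bool" where
  "column h b f \<longleftrightarrow> f 0 = b \<and> (\<forall>j\<le>h. 0 < f j) \<and> (\<forall>j<h. f (Suc j) \<le> f j)"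

text \<open>Serves pairs of type A in both shapes. If \<open>c < b\<close>, then \<open>c\<close>
  lies in the range where \<open>P\<close> compares with \<open>c\<close>, and \<open>P c\<close>
  would say \<open>Suc c \<le> c\<close>.\<close>

lemma all_less_split_iff:
  fixes b b' c :: nat
  assumes P: "\<And>i. b' \<le> i \<Longrightarrow> i < b \<Longrightarrow> P i \<longleftrightarrow> Suc i \<le> c" and "b' \<le> b" "b' \<le> c"
  shows "(\<forall>i<b. P i) \<longleftrightarrow> b \<le> c \<and> (\<forall>i<b'. P i)"
proof
  assume *: "\<forall>i<b. P i"
  have "b \<le> c"
  proof (rule ccontr)
    assume "\<not> b \<le> c"
    then show False using P[of c] * assms(3) by simp
  qed
  then show "b \<le> c \<and> (\<forall>i<b'. P i)" using * assms(2) by simp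
next
  assume *: "b \<le> c \<and> (\<forall>i<b'. P i)"
  show "\<forall>i<b. P i"
  proof (intro allI impI)
    fix i assume "i < b"
    then show "P i" using P[of i] * by (cases "i < b'") simp_all
  qed
qed

text \<open>Counterpart for pairs of type B in both shapes: if \<open>c \<le> a\<close>, then
  \<open>a' < a\<close>, and \<open>P a\<close> would say \<open>a < c\<close>.\<close>

lemma all_le_split_iff:
  fixes a a' c :: nat
  assumes P: "\<And>i. a' < i \<Longrightarrow> i \<le> a \<Longrightarrow> P i \<longleftrightarrow> i < c" and "a' \<le> a" "a' < c"
  shows "(\<forall>i\<le>a. P i) \<longleftrightarrow> a < c \<and> (\<forall>i\<le>a'. P i)"
proof
  assume *: "\<forall>i\<le>a. P i"
  have "a < c"
  proof (rule ccontr)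
    assume "\<not> a < c"
    then show False using P[of a] * assms(3) by simp
  qed
  then show "a < c \<and> (\<forall>i\<le>a'. P i)" using * assms(2) by simp
next
  assume *: "a < c \<and> (\<forall>i\<le>a'. P i)"
  show "\<forall>i\<le>a. P i"
  proof (intro allI impI)
    fix i assume "i \<le> a"
    then show "P i" using P[of i] * by (cases "i \<le> a'") simp_all
  qed
qed

text \<open>If the pair has the same type in both shapes, each triple beyond the small shape has 1
  as its middle entry, so it is inverted iff its smallest entry exceeds 1; this becomes the
  inequality between heights. If the types differ, one strict inequality,
  \<open>f i < g (Suc i)\<close> or \<open>g i < f i\<close>, inverts the triples of both shapes.
  The premises on large entries start at row 1, so the column with basement entry 1 is covered, with
  small height 0.\<close>

lemma triples_inverted_extend:
  assumes f: "column a u f" "a' \<le> a" "\<And>j. 0 < j \<Longrightarrow> j \<le> a' \<Longrightarrow> 1 < f j"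
      "\<And>j. a' < j \<Longrightarrow> j \<le> a \<Longrightarrow> f j = 1"
    and g: "column b v g" "b' \<le> b" "\<And>j. 0 < j \<Longrightarrow> j \<le> b' \<Longrightarrow> 1 < g j"
      "\<And>j. b' < j \<Longrightarrow> j \<le> b \<Longrightarrow> g j = 1"
  shows "triples_inverted a b f g \<longleftrightarrow> heights_extend a b a' b' u v \<and> triples_inverted a' b' f g"
proof -
  have fpos: "0 < f j" if "j \<le> a" for j using f that by (simp add: column_def)
  have gpos: "0 < g j" if "j \<le> b" for j using g that by (simp add: column_def)
  have fle: "f (Suc j) \<le> f j" if "j < a" for j using f that by (simp add: column_def)
  have gle: "g (Suc j) \<le> g j" if "j < b" for j using g that by (simp add: column_def)
  have u: "f 0 = u" and v: "g 0 = v" using f g by (simp_all add: column_def)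
  have f1: "1 < f j \<longleftrightarrow> j \<le> a'" if "0 < j" "j \<le> a" for j
    using f(3)[of j] f(4)[of j] that by (cases "j \<le> a'") auto
  have g1: "1 < g j \<longleftrightarrow> j \<le> b'" if "0 < j" "j \<le> b" for j
    using g(3)[of j] g(4)[of j] that by (cases "j \<le> b'") auto
  consider (AA) "b \<le> a" "b' \<le> a'" | (BB) "a < b" "a' < b'" | (AB) "b \<le> a" "a' < b'"
    | (BA) "a < b" "b' \<le> a'" by linarith
  then show ?thesis
  proof cases
    case AA
    have "inversion_triple (f (Suc i)) (g (Suc i)) (f i) \<longleftrightarrow> Suc i \<le> a'" if "b' \<le> i" "i < b" for i
    proof -
      have "g (Suc i) = 1" using g(4) that by simp
      moreover have "0 < f i" using fpos that AA by simp
      moreover have "1 < f (Suc i) \<longleftrightarrow> Suc i \<le> a'" using f1[of "Suc i"] that AA by simp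
      ultimately show ?thesis by (auto simp: inversion_triple_def)
    qed
    then have "(\<forall>i<b. inversion_triple (f (Suc i)) (g (Suc i)) (f i)) \<longleftrightarrow>
        b \<le> a' \<and> (\<forall>i<b'. inversion_triple (f (Suc i)) (g (Suc i)) (f i))"
      using g(2) AA(2) by (rule all_less_split_iff)
    then show ?thesis using AA by (simp add: triples_inverted_def heights_extend_def)
  next
    case BB
    have "inversion_triple (g (Suc i)) (f i) (g i) \<longleftrightarrow> i < b'" if "a' < i" "i \<le> a" for i
    proof -
      have "f i = 1" using f(4) that by simp
      moreover have "0 < g i" using gpos that BB by simp
      moreover have "1 < g (Suc i) \<longleftrightarrow> Suc i \<le> b'" using g1[of "Suc i"] that BB by simp
      ultimately show ?thesis by (auto simp: inversion_triple_def)
    qed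
    then have "(\<forall>i\<le>a. inversion_triple (g (Suc i)) (f i) (g i)) \<longleftrightarrow>
        a < b' \<and> (\<forall>i\<le>a'. inversion_triple (g (Suc i)) (f i) (g i))"
      using f(2) BB(2) by (rule all_le_split_iff)
    then show ?thesis using BB by (simp add: triples_inverted_def heights_extend_def)
  next
    \<comment> \<open>When the types in the two shapes differ, the rows where only one column has a one force a
      strict inequality between the columns, which propagates down to the basement.\<close>
    case AB
    show ?thesis
    proof
      assume "triples_inverted a b f g"
      then have T: "g (Suc i) < f (Suc i) \<or> f i < g (Suc i)" if "i < b" for i
        using AB that by (auto simp: triples_inverted_def inversion_triple_def not_le)
      have lt: "f i < g (Suc i)" if "i \<le> a'" for i
        using that
      proof (induction rule: inc_induct)
        case base
        have "f (Suc a') = 1" using f(4) AB g(2) by simp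
        moreover have "0 < g (Suc a')" using gpos AB g(2) by simp
        ultimately show ?case using T[of a'] AB g(2) by simp
      next
        case (step i)
        have "g (Suc (Suc i)) \<le> g (Suc i)" using gle step AB g(2) by simp
        then show ?case using T[of i] step AB g(2) by simp
      qed
      \<comment> \<open>If \<open>b' < b\<close>, the type A triple with \<open>i = b'\<close> has 1
        in both cells of row \<open>Suc b'\<close> and is not inverted.\<close>
      have "b = b'"
      proof (rule ccontr)
        assume "b \<noteq> b'"
        then have "b' < b" using g(2) by simp
        then have "g (Suc b') = 1" "f (Suc b') = 1" using g(4) f(4) AB by simp_all
        then show False using T[of b'] fpos[of b'] \<open>b' < b\<close> AB by simp
      qed
      moreover have "u < v" using lt[of 0] gle[of 0] AB g(2) u v by simp
      ultimately show "heights_extend a b a' b' u v \<and> triples_inverted a' b' f g"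
        using AB lt by (auto simp: triples_inverted_def heights_extend_def inversion_triple_def not_le)
    next
      assume *: "heights_extend a b a' b' u v \<and> triples_inverted a' b' f g"
      then have eq: "b = b'" "u < v" using AB by (auto simp: heights_extend_def)
      have T: "f i < g (Suc i) \<or> g i < f i" if "i \<le> a'" for i
        using AB that * by (auto simp: triples_inverted_def inversion_triple_def not_le)
      \<comment> \<open>Upward from the basement, where \<open>u < v\<close> excludes the second
        alternative of \<open>T\<close>; higher up it is excluded by
        \<open>f (Suc i) \<le> f i < g (Suc i)\<close>.\<close>
      have lt: "f i < g (Suc i)" if "i \<le> a'" for i
        using that
      proof (induction i)
        case 0
        then show ?case using T[of 0] eq u v by simp
      next
        case (Suc i)
        then show ?case using T[of "Suc i"] fle[of i] f(2) by simp
      qed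
      \<comment> \<open>Above row \<open>a'\<close> the left entry is 1, while \<open>b = b'\<close>
        keeps \<open>g (Suc i)\<close> above 1.\<close>
      have "f i < g (Suc i)" if "i < b" for i
      proof (cases "i \<le> a'")
        case False
        then have "f i = 1" using f(4) that AB by simp
        then show ?thesis using g(3)[of "Suc i"] that eq by simp
      qed (rule lt)
      then show "triples_inverted a b f g"
        using AB by (auto simp: triples_inverted_def inversion_triple_def not_le)
    qed
  next
    case BA
    show ?thesis
    proof
      assume "triples_inverted a b f g"
      then have T: "f i < g (Suc i) \<or> g i < f i" if "i \<le> a" for i
        using BA that by (auto simp: triples_inverted_def inversion_triple_def not_le)
      have gt: "g i < f i" if "i \<le> b'" for i
        using that
      proof (induction rule: inc_induct)
        case base
        have "g (Suc b') = 1" using g(4) BA f(2) by simp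
        moreover have "0 < f b'" using fpos BA f(2) by simp
        ultimately show ?case using T[of b'] BA f(2) by simp
      next
        case (step i)
        have "f (Suc i) \<le> f i" using fle step BA f(2) by simp
        then show ?case using T[of i] step BA f(2) by simp
      qed
      \<comment> \<open>If \<open>a' < a\<close>, then \<open>b' \<le> a'\<close> makes both
        \<open>f (Suc a')\<close> and \<open>g (Suc (Suc a'))\<close> equal to 1, so the type B
        triple with \<open>i = Suc a'\<close> is not inverted.\<close>
      have "a = a'"
      proof (rule ccontr)
        assume "a \<noteq> a'"
        then have "a' < a" using f(2) by simp
        then have "g (Suc (Suc a')) = 1" "f (Suc a') = 1" using g(4) f(4) BA by simp_all
        then show False using T[of "Suc a'"] gpos[of "Suc a'"] \<open>a' < a\<close> BA by simp
      qed
      moreover have "v < u" using gt[of 0] u v by simp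
      ultimately show "heights_extend a b a' b' u v \<and> triples_inverted a' b' f g"
        using BA gt by (auto simp: triples_inverted_def heights_extend_def inversion_triple_def not_le)
    next
      assume *: "heights_extend a b a' b' u v \<and> triples_inverted a' b' f g"
      then have eq: "a = a'" "v < u" using BA by (auto simp: heights_extend_def)
      have T: "g (Suc i) < f (Suc i) \<or> f i < g (Suc i)" if "i < b'" for i
        using BA that * by (auto simp: triples_inverted_def inversion_triple_def not_le)
      \<comment> \<open>Upward from \<open>v < u\<close>: the alternative
        \<open>f i < g (Suc i)\<close> of \<open>T\<close> is excluded by
        \<open>g (Suc i) \<le> g i < f i\<close>.\<close>
      have gt: "g i < f i" if "i \<le> b'" for i
        using that
      proof (induction i)
        case 0
        then show ?case using eq u v by simp
      next
        case (Suc i)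
        then show ?case using T[of i] gle[of i] g(2) by simp
      qed
      have "g i < f i" if "i \<le> a" for i
      proof (cases "i \<le> b'")
        case False
        then have "g i = 1" using g(4) that BA by simp
        then show ?thesis using f(3)[of i] that eq False by simp
      qed (rule gt)
      then show "triples_inverted a b f g"
        using BA by (auto simp: triples_inverted_def inversion_triple_def not_le)
    qed
  qed
qed

section \<open>Fillings and extendability as conditions on columns and pairs of columns\<close>

text \<open>The SSAF conditions apart from extensionality, sorted by column and by pair of columns
  so that the effect of deleting one column can be read off.\<close>

definition filling :: "(nat \<Rightarrow> nat) \<Rightarrow> nat list \<Rightarrow> (nat \<times> nat \<Rightarrow> nat) \<Rightarrow> bool" where
  "filling \<tau> \<alpha> F \<longleftrightarrow>
     (\<forall>i\<in>{1..length \<alpha>}. column (part \<alpha> i) (\<tau> i) (\<lambda>j. F (i, j))) \<and>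
     (\<forall>l\<in>{1..length \<alpha>}. \<forall>r\<in>{1..length \<alpha>}. l < r \<longrightarrow>
        triples_inverted (part \<alpha> l) (part \<alpha> r) (\<lambda>j. F (l, j)) (\<lambda>j. F (r, j)))"

lemma SSAF_iff_filling: "F \<in> SSAF \<tau> \<alpha> \<longleftrightarrow> F \<in> extensional (cells \<alpha>) \<and> filling \<tau> \<alpha> F"
proof -
  have A: "type_A_inversions \<alpha> F \<and> type_B_inversions \<alpha> F \<longleftrightarrow>
    (\<forall>l\<in>{1..length \<alpha>}. \<forall>r\<in>{1..length \<alpha>}. l < r \<longrightarrow>
        triples_inverted (part \<alpha> l) (part \<alpha> r) (\<lambda>j. F (l, j)) (\<lambda>j. F (r, j)))"
    (is "?A \<and> ?B \<longleftrightarrow> ?T")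
  proof
    assume *: "?A \<and> ?B"
    show ?T
    proof (intro ballI impI)
      fix l r assume lr: "l \<in> {1..length \<alpha>}" "r \<in> {1..length \<alpha>}" "l < r"
      show "triples_inverted (part \<alpha> l) (part \<alpha> r) (\<lambda>j. F (l, j)) (\<lambda>j. F (r, j))"
        using * lr
        by (auto simp: triples_inverted_def type_A_inversions_def type_B_inversions_def cells_def)
    qed
  next
    assume T: ?T
    show "?A \<and> ?B"
      unfolding type_A_inversions_def type_B_inversions_def
    proof (intro conjI allI impI; elim conjE)
      fix l r i assume *: "1 \<le> l" "l < r" "r \<le> length \<alpha>" "part \<alpha> r \<le> part \<alpha> l"
        "{(l, i + 1), (r, i + 1), (l, i)} \<subseteq> cells \<alpha>"
      then show "inversion_triple (F (l, i + 1)) (F (r, i + 1)) (F (l, i))"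
        using T[rule_format, of l r] by (auto simp: triples_inverted_def cells_def)
    next
      fix l r i assume *: "1 \<le> l" "l < r" "r \<le> length \<alpha>" "part \<alpha> l < part \<alpha> r"
        "{(r, i + 1), (l, i), (r, i)} \<subseteq> cells \<alpha>"
      then show "inversion_triple (F (r, i + 1)) (F (l, i)) (F (r, i))"
        using T[rule_format, of l r] by (auto simp: triples_inverted_def cells_def)
    qed
  qed
  show ?thesis
    unfolding SSAF_def filling_def A[symmetric] column_def
    by (auto simp: PiE_def Pi_def cells_def Suc_le_eq)
qed

lemma extendable_iff_heights_extend:
  "extendable \<tau> \<gamma> \<alpha> \<longleftrightarrow> length \<gamma> = length \<alpha> \<and>
     (\<forall>i\<in>{1..length \<alpha>}. part \<gamma> i \<le> part \<alpha> i) \<and>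
     (\<forall>l\<in>{1..length \<alpha>}. \<forall>r\<in>{1..length \<alpha>}. l < r \<longrightarrow>
        heights_extend (part \<alpha> l) (part \<alpha> r) (part \<gamma> l) (part \<gamma> r) (\<tau> l) (\<tau> r))"
proof -
  have pairs: "(\<forall>l r. 1 \<le> l \<and> l < r \<and> r \<le> m \<longrightarrow> P l r) \<longleftrightarrow>
      (\<forall>l\<in>{1..m}. \<forall>r\<in>{1..m}. l < r \<longrightarrow> P l r)" for m and P :: "nat \<Rightarrow> nat \<Rightarrow> bool"
    by auto
  show ?thesis
    unfolding extendable_def heights_extend_def pairs by (rule refl)
qed

subsection \<open>Removing the ones\<close>

text \<open>The increasing enumeration of the indices other than \<open>s\<close>: column
  \<open>i\<close> of a shape whose column \<open>s\<close> was deleted is column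
  \<open>skip s i\<close> of the original.\<close>

definition skip :: "nat \<Rightarrow> nat \<Rightarrow> nat" where
  "skip s i = (if i < s then i else Suc i)"

lemma skip_neq [simp]: "skip s i \<noteq> s" "s \<noteq> skip s i"
  by (auto simp: skip_def)

lemma skip_less_iff [simp]: "skip s i < skip s j \<longleftrightarrow> i < j"
  by (auto simp: skip_def)

lemma inj_skip: "inj (skip s)"
  by (auto simp: skip_def inj_def split: if_splits)

lemma atLeastAtMost_eq_insert_skip:
  assumes "s \<in> {1..Suc m}"
  shows "{1..Suc m} = insert s (skip s ` {1..m})"
proof -
  have "x \<in> insert s (skip s ` {1..m})" if "x \<in> {1..Suc m}" for x
  proof -
    consider "x < s" | "x = s" | "s < x" by linarith
    then show ?thesis
    proof cases
      case 1
      then have "x = skip s x" "x \<in> {1..m}" using that assms by (auto simp: skip_def)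
      then show ?thesis by blast
    next
      case 3
      then have "x = skip s (x - 1)" "x - 1 \<in> {1..m}" using that assms by (auto simp: skip_def)
      then show ?thesis by blast
    qed simp
  qed
  moreover have "insert s (skip s ` {1..m}) \<subseteq> {1..Suc m}"
    using assms by (auto simp: skip_def)
  ultimately show ?thesis by blast
qed

lemma length_insert_zero [simp]: "length (insert_zero s \<beta>) = Suc (length \<beta>)"
  by (simp add: insert_zero_def)

lemma sum_list_insert_zero [simp]: "sum_list (insert_zero s \<beta>) = sum_list \<beta>"
  using sum_list_append[of "take (s - 1) \<beta>" "drop (s - 1) \<beta>"] by (simp add: insert_zero_def)

lemma part_insert_zero:
  assumes "s \<in> {1..Suc (length \<beta>)}"
  shows "part (insert_zero s \<beta>) s = 0"
    and "i \<in> {1..length \<beta>} \<Longrightarrow> part (insert_zero s \<beta>) (skip s i) = part \<beta> i"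
  using assms
  by (auto simp: part_def insert_zero_def skip_def nth_append nth_Cons' nth_tl min_def)

text \<open>The graph of the bijection \<open>F\<close> to \<open>(\<beta>, G)\<close>, kept as a
  relation so that fillings and weights are compared once for both directions. Row 0 is included,
  hence basement entries are lowered too; the condition \<open>0 < G (i, j)\<close> says that the
  corresponding entry of \<open>F\<close> exceeds 1.\<close>

definition decomposes ::
    "nat \<Rightarrow> nat list \<Rightarrow> nat list \<Rightarrow> (nat \<times> nat \<Rightarrow> nat) \<Rightarrow> (nat \<times> nat \<Rightarrow> nat) \<Rightarrow> bool" where
  "decomposes s \<alpha> \<beta> F G \<longleftrightarrow>
     length \<alpha> = Suc (length \<beta>) \<and> s \<in> {1..length \<alpha>} \<and>
     (\<forall>j\<le>part \<alpha> s. F (s, j) = 1) \<and>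
     (\<forall>i\<in>{1..length \<beta>}. part \<beta> i \<le> part \<alpha> (skip s i) \<and>
        (\<forall>j\<le>part \<beta> i. 0 < G (i, j) \<and> F (skip s i, j) = Suc (G (i, j))) \<and>
        (\<forall>j. part \<beta> i < j \<and> j \<le> part \<alpha> (skip s i) \<longrightarrow> F (skip s i, j) = 1))"

text \<open>The ones on top satisfy positivity and monotonicity automatically, and subtracting 1
  from the other entries keeps their order.\<close>

lemma column_Suc_iff:
  assumes "h' \<le> h" "\<And>j. j \<le> h' \<Longrightarrow> 0 < g j \<and> f j = Suc (g j)"
    "\<And>j. h' < j \<Longrightarrow> j \<le> h \<Longrightarrow> f j = 1"
  shows "column h (Suc u) f \<longleftrightarrow> column h' u g"
proof -
  have pos: "0 < f j" if "j \<le> h" for j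
    using assms(2,3)[of j] that by (cases "j \<le> h'") simp_all
  moreover have "f (Suc j) \<le> f j" if "h' \<le> j" "j < h" for j
    using assms(3)[of "Suc j"] pos[of j] that by simp
  then have "(\<forall>j<h. f (Suc j) \<le> f j) \<longleftrightarrow> (\<forall>j<h'. f (Suc j) \<le> f j)"
    using assms(1) by (meson less_le_trans linorder_not_less)
  ultimately show ?thesis
    using assms(2) by (simp add: column_def)
qed

lemma triples_inverted_Suc:
  assumes "\<And>j. j \<le> a \<Longrightarrow> f' j = Suc (f j)" "\<And>j. j \<le> b \<Longrightarrow> g' j = Suc (g j)"
  shows "triples_inverted a b f' g' \<longleftrightarrow> triples_inverted a b f g"
  using assms by (simp add: triples_inverted_def inversion_triple_def)

text \<open>The intermediate shape \<open>\<gamma> = insert_zero s \<beta>\<close> still has all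
  columns of \<open>\<alpha>\<close>. Passing from \<open>\<alpha>\<close> to
  \<open>\<gamma>\<close> splits off extendability pair by pair; passing from
  \<open>\<gamma>\<close> to \<open>\<beta>\<close> only drops an empty column and lowers
  entries.\<close>

lemma filling_decomposes_iff:
  assumes D: "decomposes s \<alpha> \<beta> F G" and s: "\<tau> s = 1"
    and \<tau>: "\<And>i. i \<in> {1..length \<beta>} \<Longrightarrow> \<tau> (skip s i) = Suc (\<tau>' i)"
  shows "filling \<tau> \<alpha> F \<longleftrightarrow> extendable \<tau> (insert_zero s \<beta>) \<alpha> \<and> filling \<tau>' \<beta> G"
proof -
  define \<gamma> where "\<gamma> = insert_zero s \<beta>"
  have len: "length \<alpha> = Suc (length \<beta>)" and s_in: "s \<in> {1..Suc (length \<beta>)}"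
    using D by (auto simp: decomposes_def)
  have I: "{1..length \<alpha>} = insert s (skip s ` {1..length \<beta>})"
    unfolding len by (rule atLeastAtMost_eq_insert_skip[OF s_in])
  have \<gamma>s: "part \<gamma> s = 0" unfolding \<gamma>_def by (rule part_insert_zero(1)[OF s_in])
  have \<gamma>: "part \<gamma> (skip s i) = part \<beta> i" if "i \<in> {1..length \<beta>}" for i
    unfolding \<gamma>_def by (rule part_insert_zero(2)[OF s_in that])
  have Fs: "F (s, j) = 1" if "j \<le> part \<alpha> s" for j
    using D that by (simp add: decomposes_def)
  have le: "part \<beta> i \<le> part \<alpha> (skip s i)" if "i \<in> {1..length \<beta>}" for i
    using D that by (simp add: decomposes_def)
  have FG: "0 < G (i, j) \<and> F (skip s i, j) = Suc (G (i, j))"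
    if "i \<in> {1..length \<beta>}" "j \<le> part \<beta> i" for i j
    using D that by (simp add: decomposes_def)
  have F1: "F (skip s i, j) = 1"
    if "i \<in> {1..length \<beta>}" "part \<beta> i < j" "j \<le> part \<alpha> (skip s i)" for i j
    using D that by (simp add: decomposes_def)
  let ?T = "\<lambda>\<alpha> F l r. triples_inverted (part \<alpha> l) (part \<alpha> r) (\<lambda>j. F (l, j)) (\<lambda>j. F (r, j))"
  let ?col = "\<lambda>\<tau> \<alpha> F i. column (part \<alpha> i) (\<tau> i) (\<lambda>j. F (i, j))"
  let ?E = "\<lambda>l r. heights_extend (part \<alpha> l) (part \<alpha> r) (part \<gamma> l) (part \<gamma> r) (\<tau> l) (\<tau> r)"
  have col: "(\<forall>i\<in>{1..length \<alpha>}. ?col \<tau> \<alpha> F i) \<longleftrightarrow> (\<forall>i\<in>{1..length \<beta>}. ?col \<tau>' \<beta> G i)"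
  proof -
    have "?col \<tau> \<alpha> F s" using Fs s by (simp add: column_def)
    moreover have "?col \<tau> \<alpha> F (skip s i) \<longleftrightarrow> ?col \<tau>' \<beta> G i" if "i \<in> {1..length \<beta>}" for i
      unfolding \<tau>[OF that]
      by (rule column_Suc_iff[OF le[OF that] FG[OF that] F1[OF that]])
    ultimately show ?thesis unfolding I by simp
  qed
  have \<gamma>_le: "part \<gamma> i \<le> part \<alpha> i" if "i \<in> {1..length \<alpha>}" for i
    using that \<gamma> \<gamma>s le unfolding I by auto
  have big: "1 < F (i, j)" if "i \<in> {1..length \<alpha>}" "0 < j" "j \<le> part \<gamma> i" for i j
    using that \<gamma> \<gamma>s FG unfolding I by auto
  have one: "F (i, j) = 1" if "i \<in> {1..length \<alpha>}" "part \<gamma> i < j" "j \<le> part \<alpha> i" for i j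
    using that \<gamma> \<gamma>s F1 Fs unfolding I by auto
  \<comment> \<open>The comparison of triples relies on the column conditions; \<open>col\<close>
    makes these available on both sides of the final equivalence.\<close>
  have pair: "?T \<alpha> F l r \<longleftrightarrow> ?E l r \<and> ?T \<gamma> F l r"
    if c: "\<forall>i\<in>{1..length \<alpha>}. ?col \<tau> \<alpha> F i" and lr: "l \<in> {1..length \<alpha>}" "r \<in> {1..length \<alpha>}" for l r
    by (rule triples_inverted_extend[OF bspec[OF c lr(1)] \<gamma>_le[OF lr(1)] big[OF lr(1)] one[OF lr(1)]
          bspec[OF c lr(2)] \<gamma>_le[OF lr(2)] big[OF lr(2)] one[OF lr(2)]])
  have pairs: "(\<forall>l\<in>{1..length \<alpha>}. \<forall>r\<in>{1..length \<alpha>}. l < r \<longrightarrow> ?T \<gamma> F l r) \<longleftrightarrow>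
      (\<forall>l\<in>{1..length \<beta>}. \<forall>r\<in>{1..length \<beta>}. l < r \<longrightarrow> ?T \<beta> G l r)"
  proof -
    \<comment> \<open>Column \<open>s\<close> has height 0 in \<open>\<gamma>\<close>. To the left
      of a nonempty column it meets only the type B triple with \<open>i = 0\<close>, inverted since
      \<open>F (s, 0) = 1 < F (r, 1)\<close>; otherwise it meets no triple.\<close>
    have "?T \<gamma> F s r" if "r \<in> {1..length \<alpha>}" for r
    proof (cases "part \<gamma> r = 0")
      case False
      then have "1 < F (r, Suc 0)" using big[OF that, of "Suc 0"] by simp
      then show ?thesis using \<gamma>s Fs[of 0] by (simp add: triples_inverted_def inversion_triple_def)
    qed (simp add: triples_inverted_def \<gamma>s)
    moreover have "?T \<gamma> F l s" for l by (simp add: triples_inverted_def \<gamma>s)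
    moreover have "?T \<gamma> F (skip s l) (skip s r) \<longleftrightarrow> ?T \<beta> G l r"
      if "l \<in> {1..length \<beta>}" "r \<in> {1..length \<beta>}" for l r
      unfolding \<gamma>[OF that(1)] \<gamma>[OF that(2)]
      using FG that by (intro triples_inverted_Suc) blast+
    ultimately show ?thesis unfolding I by simp
  qed
  have ext: "extendable \<tau> \<gamma> \<alpha> \<longleftrightarrow>
      (\<forall>l\<in>{1..length \<alpha>}. \<forall>r\<in>{1..length \<alpha>}. l < r \<longrightarrow> ?E l r)"
    using \<gamma>_le len unfolding extendable_iff_heights_extend by (simp add: \<gamma>_def)
  show ?thesis
    unfolding filling_def \<gamma>_def[symmetric] ext col[symmetric] pairs[symmetric]
    using pair by blast
qed

section \<open>The bijection: stripping and padding\<close>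

text \<open>Columns weakly decrease, so the count is the height up to which the entries exceed 1.
  The basement row is not counted.\<close>

definition big_shape :: "nat \<Rightarrow> nat list \<Rightarrow> (nat \<times> nat \<Rightarrow> nat) \<Rightarrow> nat list" where
  "big_shape s \<alpha> F =
     map (\<lambda>i. card {j \<in> {1..part \<alpha> (skip s i)}. 1 < F (skip s i, j)}) [1..<length \<alpha>]"

definition strip :: "nat \<Rightarrow> nat list \<Rightarrow> (nat \<times> nat \<Rightarrow> nat) \<Rightarrow> nat \<times> nat \<Rightarrow> nat" where
  "strip s \<beta> F = (\<lambda>(i, j)\<in>cells \<beta>. F (skip s i, j) - 1)"

text \<open>The inverse of \<open>strip\<close>; \<open>if i < s then i else i - 1\<close> undoes
  \<open>skip s\<close>. The test \<open>i \<noteq> s\<close> matters for the basement cell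
  \<open>(s, 0)\<close>, which would otherwise pass \<open>j \<le> 0\<close> and be raised.\<close>

definition pad :: "nat \<Rightarrow> nat list \<Rightarrow> nat list \<Rightarrow> (nat \<times> nat \<Rightarrow> nat) \<Rightarrow> nat \<times> nat \<Rightarrow> nat" where
  "pad s \<alpha> \<beta> G = (\<lambda>(i, j)\<in>cells \<alpha>.
     if i \<noteq> s \<and> j \<le> part (insert_zero s \<beta>) i then Suc (G (if i < s then i else i - 1, j)) else 1)"

lemma unskip_skip [simp]: "(if skip s i < s then skip s i else skip s i - 1) = i"
  by (simp add: skip_def)

lemma part_map_upt: "i \<in> {1..m} \<Longrightarrow> part (map f [1..<Suc m]) i = f i"
  by (auto simp: part_def nth_append simp del: upt_Suc)

lemma part_eqI:
  assumes "length \<alpha> = length \<beta>" "\<And>i. i \<in> {1..length \<beta>} \<Longrightarrow> part \<alpha> i = part \<beta> i"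
  shows "\<alpha> = \<beta>"
proof (rule nth_equalityI[OF assms(1)])
  fix i assume "i < length \<alpha>"
  then show "\<alpha> ! i = \<beta> ! i" using assms(2)[of "Suc i"] assms(1) by (simp add: part_def)
qed

lemma column_antitone:
  assumes "column h b f" "i \<le> j" "j \<le> h"
  shows "f j \<le> f i"
  using assms(2,3)
proof (induction rule: dec_induct)
  case (step j)
  then have "f (Suc j) \<le> f j" using assms(1) by (simp add: column_def)
  then show ?case using step by simp
qed simp

text \<open>The rows with entries above 1 are closed downwards, hence form an initial segment
  \<open>{1..p}\<close>, and \<open>p\<close> is their number.\<close>

lemma column_big_iff:
  assumes "column h b f" "0 < j" "j \<le> h"
  shows "1 < f j \<longleftrightarrow> j \<le> card {j \<in> {1..h}. 1 < f j}"
proof -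
  define S where "S = {j \<in> {1..h}. 1 < f j}"
  have fin: "finite S" by (simp add: S_def)
  \<comment> \<open>The inserted 0 gives \<open>p = 0\<close> when no entry above the basement
    exceeds 1.\<close>
  define p where "p = Max (insert 0 S)"
  have p: "p \<in> insert 0 S" unfolding p_def using fin by (intro Max_in) simp_all
  have "S = {1..p}"
  proof
    show "S \<subseteq> {1..p}" using fin by (auto simp: S_def p_def)
    show "{1..p} \<subseteq> S"
    proof
      fix i assume i: "i \<in> {1..p}"
      then have "p \<in> S" using p by auto
      moreover have "f p \<le> f i" using column_antitone[OF assms(1)] i \<open>p \<in> S\<close> by (simp add: S_def)
      ultimately show "i \<in> S" using i by (auto simp: S_def)
    qed
  qed
  then have "j \<in> S \<longleftrightarrow> j \<le> card S" using assms(2) by simp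
  then show ?thesis using assms(2,3) by (simp add: S_def)
qed

text \<open>Forward direction: column \<open>s\<close> starts at 1, decreases weakly and stays
  positive, so it is constant; in the other columns the ones begin just above the counted
  height.\<close>

lemma decomposes_strip:
  assumes F: "filling \<tau> \<alpha> F" and s: "s \<in> {1..length \<alpha>}" "\<tau> s = 1"
    and \<tau>: "\<And>i. i \<in> {1..<length \<alpha>} \<Longrightarrow> 1 < \<tau> (skip s i)"
  shows "decomposes s \<alpha> (big_shape s \<alpha> F) F (strip s (big_shape s \<alpha> F) F)"
proof -
  define \<beta> where "\<beta> = big_shape s \<alpha> F"
  obtain m where m: "length \<alpha> = Suc m" using s by (cases "length \<alpha>") auto
  have len: "length \<beta> = m" by (simp add: \<beta>_def big_shape_def m)
  have s_in: "s \<in> {1..Suc m}" using s m by simp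
  have col: "column (part \<alpha> i) (\<tau> i) (\<lambda>j. F (i, j))" if "i \<in> {1..length \<alpha>}" for i
    using F that by (simp add: filling_def)
  have skip_in: "skip s i \<in> {1..length \<alpha>}" if "i \<in> {1..m}" for i
    using that unfolding m atLeastAtMost_eq_insert_skip[OF s_in] by simp
  have \<beta>: "part \<beta> i = card {j \<in> {1..part \<alpha> (skip s i)}. 1 < F (skip s i, j)}"
    if "i \<in> {1..m}" for i
    unfolding \<beta>_def big_shape_def m by (rule part_map_upt[OF that])
  have le: "part \<beta> i \<le> part \<alpha> (skip s i)" if "i \<in> {1..m}" for i
  proof -
    have "part \<beta> i \<le> card {1..part \<alpha> (skip s i)}"
      unfolding \<beta>[OF that] by (rule card_mono) auto
    then show ?thesis by simp
  qed
  have big: "1 < F (skip s i, j) \<longleftrightarrow> j \<le> part \<beta> i"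
    if "i \<in> {1..m}" "j \<le> part \<alpha> (skip s i)" for i j
  proof (cases "j = 0")
    \<comment> \<open>In the basement both sides hold, since the entry
      \<open>\<tau> (skip s i)\<close> exceeds 1.\<close>
    case True
    then show ?thesis using col[OF skip_in[OF that(1)]] \<tau>[of i] that m by (simp add: column_def)
  next
    case False
    then show ?thesis
      using column_big_iff[OF col[OF skip_in[OF that(1)]], of j] that by (simp add: \<beta>)
  qed
  have pos: "0 < F (i, j)" if "i \<in> {1..length \<alpha>}" "j \<le> part \<alpha> i" for i j
    using col[OF that(1)] that(2) by (simp add: column_def)
  have Fs: "F (s, j) = 1" if "j \<le> part \<alpha> s" for j
  proof -
    have "F (s, j) \<le> F (s, 0)" using column_antitone[OF col[OF s(1)]] that by simp
    moreover have "F (s, 0) = 1" using col[OF s(1)] s(2) by (simp add: column_def)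
    ultimately show ?thesis using pos[OF s(1) that] by simp
  qed
  have "0 < strip s \<beta> F (i, j) \<and> F (skip s i, j) = Suc (strip s \<beta> F (i, j))"
    if "i \<in> {1..m}" "j \<le> part \<beta> i" for i j
    using big[of i j] le[of i] that len by (simp add: strip_def cells_def)
  moreover have "F (skip s i, j) = 1"
    if "i \<in> {1..m}" "part \<beta> i < j" "j \<le> part \<alpha> (skip s i)" for i j
    using big[OF that(1,3)] pos[OF skip_in[OF that(1)] that(3)] that(2) by simp
  ultimately show ?thesis
    unfolding \<beta>_def[symmetric] using s Fs le m len by (simp add: decomposes_def)
qed

text \<open>Backward direction: the bound \<open>le\<close> keeps the raised entries inside
  \<open>\<alpha>\<close>, and the remaining cells receive ones.\<close>

lemma decomposes_pad:
  assumes "length \<alpha> = Suc (length \<beta>)" and s: "s \<in> {1..length \<alpha>}"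
    and le: "\<And>i. i \<in> {1..length \<beta>} \<Longrightarrow> part \<beta> i \<le> part \<alpha> (skip s i)"
    and pos: "\<And>i j. (i, j) \<in> cells \<beta> \<Longrightarrow> 0 < G (i, j)"
  shows "decomposes s \<alpha> \<beta> (pad s \<alpha> \<beta> G) G"
proof -
  have s_in: "s \<in> {1..Suc (length \<beta>)}" using assms by simp
  have skip_in: "skip s i \<in> {1..length \<alpha>}" if "i \<in> {1..length \<beta>}" for i
    using that unfolding assms(1) atLeastAtMost_eq_insert_skip[OF s_in] by simp
  have pad: "pad s \<alpha> \<beta> G (skip s i, j) = (if j \<le> part \<beta> i then Suc (G (i, j)) else 1)"
    if "i \<in> {1..length \<beta>}" "j \<le> part \<alpha> (skip s i)" for i j
    using skip_in[OF that(1)] part_insert_zero(2)[OF s_in that(1)] that(2)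
    by (simp add: pad_def cells_def)
  moreover have "pad s \<alpha> \<beta> G (s, j) = 1" if "j \<le> part \<alpha> s" for j
    using s that by (simp add: pad_def cells_def)
  moreover have "0 < G (i, j)" if "i \<in> {1..length \<beta>}" "j \<le> part \<beta> i" for i j
    using pos that by (simp add: cells_def)
  moreover have "pad s \<alpha> \<beta> G (skip s i, j) = Suc (G (i, j))"
    if "i \<in> {1..length \<beta>}" "j \<le> part \<beta> i" for i j
    using pad[of i j] le[of i] that by simp
  moreover have "pad s \<alpha> \<beta> G (skip s i, j) = 1"
    if "i \<in> {1..length \<beta>}" "part \<beta> i < j" "j \<le> part \<alpha> (skip s i)" for i j
    using pad[of i j] that by simp
  ultimately show ?thesis
    using assms(1) s le by (simp add: decomposes_def)
qed

text \<open>\<open>F\<close> determines \<open>\<beta>\<close> and then \<open>G\<close> on the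
  cells, and \<open>G\<close> determines \<open>F\<close>; with extensionality this makes stripping
  and padding mutually inverse.\<close>

lemma decomposes_unique:
  assumes D: "decomposes s \<alpha> \<beta> F G"
  shows "big_shape s \<alpha> F = \<beta>"
    and "G \<in> extensional (cells \<beta>) \<Longrightarrow> strip s \<beta> F = G"
    and "F \<in> extensional (cells \<alpha>) \<Longrightarrow> pad s \<alpha> \<beta> G = F"
proof -
  have len: "length \<alpha> = Suc (length \<beta>)" and s_in: "s \<in> {1..Suc (length \<beta>)}"
    using D by (auto simp: decomposes_def)
  show "big_shape s \<alpha> F = \<beta>"
  proof (rule part_eqI)
    fix i assume i: "i \<in> {1..length \<beta>}"
    have "{j \<in> {1..part \<alpha> (skip s i)}. 1 < F (skip s i, j)} = {1..part \<beta> i}"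
    proof (intro set_eqI iffI)
      fix j assume j: "j \<in> {j \<in> {1..part \<alpha> (skip s i)}. 1 < F (skip s i, j)}"
      then have "\<not> part \<beta> i < j" using D i by (auto simp: decomposes_def)
      then show "j \<in> {1..part \<beta> i}" using j by simp
    next
      fix j assume "j \<in> {1..part \<beta> i}"
      then show "j \<in> {j \<in> {1..part \<alpha> (skip s i)}. 1 < F (skip s i, j)}"
        using D i by (auto simp: decomposes_def intro: order_trans)
    qed
    then show "part (big_shape s \<alpha> F) i = part \<beta> i"
      unfolding big_shape_def len part_map_upt[OF i] by simp
  qed (simp add: big_shape_def len del: upt_Suc)
  show "strip s \<beta> F = G" if "G \<in> extensional (cells \<beta>)"
  proof (rule extensionalityI[OF _ that])
    fix c assume "c \<in> cells \<beta>"
    then show "strip s \<beta> F c = G c"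
      using D by (auto simp: strip_def cells_def decomposes_def)
  qed (auto simp: strip_def)
  show "pad s \<alpha> \<beta> G = F" if "F \<in> extensional (cells \<alpha>)"
  proof (rule extensionalityI[OF _ that])
    fix c assume c: "c \<in> cells \<alpha>"
    obtain i j where ij: "c = (i, j)" by (cases c)
    have "i \<in> insert s (skip s ` {1..length \<beta>})"
      using c ij len atLeastAtMost_eq_insert_skip[OF s_in] by (auto simp: cells_def)
    then consider "i = s" | i' where "i = skip s i'" "i' \<in> {1..length \<beta>}" by blast
    then show "pad s \<alpha> \<beta> G c = F c"
    proof cases
      case 1
      then show ?thesis using c ij D by (simp add: pad_def cells_def decomposes_def)
    next
      case 2
      then show ?thesis using c ij D part_insert_zero(2)[OF s_in 2(2)]
        by (auto simp: pad_def cells_def decomposes_def)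
    qed
  qed (auto simp: pad_def)
qed

section \<open>Weights and the recursion for atoms\<close>

lemma nonbasement_cells_eq: "nonbasement_cells \<alpha> = (SIGMA i:{1..length \<alpha>}. {1..part \<alpha> i})"
  by (auto simp: nonbasement_cells_def cells_def)

lemma finite_nonbasement_cells: "finite (nonbasement_cells \<alpha>)"
  by (simp add: nonbasement_cells_eq)

lemma card_nonbasement_cells: "card (nonbasement_cells \<alpha>) = sum_list \<alpha>"
proof -
  have "card (nonbasement_cells \<alpha>) = (\<Sum>i\<in>{1..length \<alpha>}. part \<alpha> i)"
    by (simp add: nonbasement_cells_eq)
  also have "\<dots> = (\<Sum>i<length \<alpha>. \<alpha> ! i)"
    by (rule sum.reindex_bij_witness[of _ Suc "\<lambda>i. i - 1"]) (auto simp: part_def)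
  finally show ?thesis by (simp add: sum_list_sum_nth atLeast0LessThan)
qed

text \<open>The injection \<open>h\<close> embeds the cells of \<open>\<beta>\<close> into those of
  \<open>\<alpha>\<close>. On its image \<open>F c + k\<close> becomes \<open>G c + Suc k\<close>;
  the remaining \<open>|\<alpha>| - |\<beta>|\<close> non-basement cells contain 1 and contribute
  \<open>X (Suc k)\<close> each.\<close>

lemma decomposes_weight:
  assumes D: "decomposes s \<alpha> \<beta> F G"
  shows "(\<Prod>c\<in>nonbasement_cells \<alpha>. X (F c + k)) =
    X (Suc k) ^ (sum_list \<alpha> - sum_list \<beta>) * (\<Prod>c\<in>nonbasement_cells \<beta>. X (G c + Suc k))"
proof -
  define h where "h = (\<lambda>(i, j :: nat). (skip s i, j))"
  have len: "length \<alpha> = Suc (length \<beta>)" and s_in: "s \<in> {1..Suc (length \<beta>)}"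
    using D by (auto simp: decomposes_def)
  have I: "{1..length \<alpha>} = insert s (skip s ` {1..length \<beta>})"
    unfolding len by (rule atLeastAtMost_eq_insert_skip[OF s_in])
  have inj: "inj_on h A" for A
    using inj_skip[of s] by (auto simp: h_def inj_on_def)
  have sub: "h ` nonbasement_cells \<beta> \<subseteq> nonbasement_cells \<alpha>"
    using D unfolding nonbasement_cells_eq I
    by (auto simp: h_def decomposes_def intro: order_trans)
  have one: "F c = 1" if "c \<in> nonbasement_cells \<alpha> - h ` nonbasement_cells \<beta>" for c
  proof -
    obtain i j where ij: "c = (i, j)" by (cases c)
    then have "i \<in> insert s (skip s ` {1..length \<beta>})" and j: "0 < j" "j \<le> part \<alpha> i"
      using that unfolding nonbasement_cells_eq I by auto
    then consider "i = s" | i' where "i = skip s i'" "i' \<in> {1..length \<beta>}" by blast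
    then show ?thesis
    proof cases
      case 1
      then show ?thesis using D ij j by (simp add: decomposes_def)
    next
      case 2
      have "\<not> j \<le> part \<beta> i'"
      proof
        assume "j \<le> part \<beta> i'"
        then have "(i', j) \<in> nonbasement_cells \<beta>" using 2 j by (simp add: nonbasement_cells_eq)
        then have "h (i', j) \<in> h ` nonbasement_cells \<beta>" by (rule imageI)
        then show False using that ij 2 by (simp add: h_def)
      qed
      then show ?thesis using D ij j 2 by (simp add: decomposes_def)
    qed
  qed
  have "(\<Prod>c\<in>nonbasement_cells \<alpha>. X (F c + k)) =
      (\<Prod>c\<in>nonbasement_cells \<alpha> - h ` nonbasement_cells \<beta>. X (F c + k)) *
      (\<Prod>c\<in>h ` nonbasement_cells \<beta>. X (F c + k))"
    by (rule prod.subset_diff[OF sub finite_nonbasement_cells])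
  also have "(\<Prod>c\<in>nonbasement_cells \<alpha> - h ` nonbasement_cells \<beta>. X (F c + k)) =
      (\<Prod>c\<in>nonbasement_cells \<alpha> - h ` nonbasement_cells \<beta>. X (Suc k))"
    using one by (intro prod.cong) simp_all
  also have "\<dots> = X (Suc k) ^ (sum_list \<alpha> - sum_list \<beta>)"
    using sub by (simp add: card_Diff_subset finite_nonbasement_cells card_image inj
        card_nonbasement_cells)
  also have "(\<Prod>c\<in>h ` nonbasement_cells \<beta>. X (F c + k)) =
      (\<Prod>c\<in>nonbasement_cells \<beta>. X (G c + Suc k))"
    unfolding prod.reindex[OF inj] using D
    by (intro prod.cong) (auto simp: nonbasement_cells_eq h_def decomposes_def)
  finally show ?thesis .
qed

text \<open>The shift by \<open>k\<close> restores the entries that were lowered \<open>k\<close> times.\<close>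

definition shifted_atom :: "nat \<Rightarrow> (nat \<Rightarrow> nat) \<Rightarrow> nat list \<Rightarrow> mpoly" where
  "shifted_atom k \<tau> \<alpha> = (\<Sum>F\<in>SSAF \<tau> \<alpha>. \<Prod>c\<in>nonbasement_cells \<alpha>. X (F c + k))"

text \<open>Length and size of \<open>\<beta>\<close> are bounded by those of
  \<open>\<alpha>\<close>. This lets the sum over pairs \<open>(\<beta>, G)\<close> be written as an
  iterated sum.\<close>

lemma finite_extendable: "finite {\<beta>. extendable \<tau> (insert_zero s \<beta>) \<alpha>}"
proof (rule finite_subset)
  show "{\<beta>. extendable \<tau> (insert_zero s \<beta>) \<alpha>} \<subseteq>
      {\<beta>. set \<beta> \<subseteq> {..sum_list \<alpha>} \<and> length \<beta> \<le> length \<alpha>}"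
  proof
    fix \<beta> assume "\<beta> \<in> {\<beta>. extendable \<tau> (insert_zero s \<beta>) \<alpha>}"
    then have "Suc (length \<beta>) = length \<alpha>" "sum_list \<beta> \<le> sum_list \<alpha>"
      using extendable_sum_le[of \<tau> "insert_zero s \<beta>" \<alpha>] by (auto simp: extendable_def)
    then show "\<beta> \<in> {\<beta>. set \<beta> \<subseteq> {..sum_list \<alpha>} \<and> length \<beta> \<le> length \<alpha>}"
      by (auto intro: order_trans[OF member_le_sum_list])
  qed
qed (rule finite_lists_length_le, simp)

text \<open>Stripping matches the SSAFs of shape \<open>\<alpha>\<close> with the pairs of an
  admissible \<open>\<beta>\<close> and an SSAF of shape \<open>\<beta>\<close>; the ones removed
  account for the power of \<open>X (Suc k)\<close>.\<close>

lemma shifted_atom_rec: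
  assumes s: "s \<in> {1..length \<alpha>}" "\<tau> s = 1"
    and \<tau>: "\<And>i. i \<in> {1..<length \<alpha>} \<Longrightarrow> \<tau> (skip s i) = Suc (\<tau>' i)"
    and \<tau>': "\<And>i. i \<in> {1..<length \<alpha>} \<Longrightarrow> 0 < \<tau>' i"
  shows "shifted_atom k \<tau> \<alpha> = (\<Sum>\<beta> | extendable \<tau> (insert_zero s \<beta>) \<alpha>.
    X (Suc k) ^ (sum_list \<alpha> - sum_list \<beta>) * shifted_atom (Suc k) \<tau>' \<beta>)"
proof -
  let ?E = "{\<beta>. extendable \<tau> (insert_zero s \<beta>) \<alpha>}"
  let ?w = "\<lambda>k \<alpha> F. \<Prod>c\<in>nonbasement_cells \<alpha>. X (F c + k)"
  have fwd: "decomposes s \<alpha> (big_shape s \<alpha> F) F (strip s (big_shape s \<alpha> F) F)"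
    if "F \<in> SSAF \<tau> \<alpha>" for F
  proof (rule decomposes_strip)
    show "filling \<tau> \<alpha> F" using that by (simp add: SSAF_iff_filling)
    show "1 < \<tau> (skip s i)" if "i \<in> {1..<length \<alpha>}" for i using \<tau>[OF that] \<tau>'[OF that] by simp
  qed (rule s)+
  have bwd: "decomposes s \<alpha> \<beta> (pad s \<alpha> \<beta> G) G" if "\<beta> \<in> ?E" "G \<in> SSAF \<tau>' \<beta>" for \<beta> G
  proof (rule decomposes_pad)
    have ext: "extendable \<tau> (insert_zero s \<beta>) \<alpha>" using that by simp
    then show len: "length \<alpha> = Suc (length \<beta>)" by (simp add: extendable_def)
    fix i assume i: "i \<in> {1..length \<beta>}"
    have s_in: "s \<in> {1..Suc (length \<beta>)}" using s len by simp
    have "skip s i \<in> {1..length \<alpha>}"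
      using i unfolding len atLeastAtMost_eq_insert_skip[OF s_in] by simp
    then show "part \<beta> i \<le> part \<alpha> (skip s i)"
      using ext unfolding extendable_def by (metis part_insert_zero(2)[OF s_in i])
  next
    show "0 < G (i, j)" if "(i, j) \<in> cells \<beta>" for i j
      using \<open>G \<in> SSAF \<tau>' \<beta>\<close> that by (auto simp: SSAF_def PiE_def)
  qed (rule s)
  have iff: "filling \<tau> \<alpha> F \<longleftrightarrow> extendable \<tau> (insert_zero s \<beta>) \<alpha> \<and> filling \<tau>' \<beta> G"
    if "decomposes s \<alpha> \<beta> F G" for \<beta> F G
  proof (rule filling_decomposes_iff[where \<tau> = \<tau> and \<tau>' = \<tau>', OF that s(2)])
    show "\<tau> (skip s i) = Suc (\<tau>' i)" if "i \<in> {1..length \<beta>}" for i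
      using \<tau>[of i] that \<open>decomposes s \<alpha> \<beta> F G\<close> by (simp add: decomposes_def)
  qed
  have "shifted_atom k \<tau> \<alpha> = (\<Sum>(\<beta>, G)\<in>(SIGMA \<beta>:?E. SSAF \<tau>' \<beta>).
      X (Suc k) ^ (sum_list \<alpha> - sum_list \<beta>) * ?w (Suc k) \<beta> G)"
    unfolding shifted_atom_def
  proof (rule sum.reindex_bij_witness[where i = "\<lambda>(\<beta>, G). pad s \<alpha> \<beta> G"
        and j = "\<lambda>F. (big_shape s \<alpha> F, strip s (big_shape s \<alpha> F) F)"])
    fix F assume F: "F \<in> SSAF \<tau> \<alpha>"
    note D = fwd[OF F]
    show "(case (big_shape s \<alpha> F, strip s (big_shape s \<alpha> F) F) of (\<beta>, G) \<Rightarrow> pad s \<alpha> \<beta> G) = F"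
      using decomposes_unique(3)[OF D] F by (simp add: SSAF_iff_filling)
    show "(big_shape s \<alpha> F, strip s (big_shape s \<alpha> F) F) \<in> (SIGMA \<beta>:?E. SSAF \<tau>' \<beta>)"
      using iff[OF D] F by (auto simp: SSAF_iff_filling strip_def)
    show "(case (big_shape s \<alpha> F, strip s (big_shape s \<alpha> F) F) of (\<beta>, G) \<Rightarrow>
        X (Suc k) ^ (sum_list \<alpha> - sum_list \<beta>) * ?w (Suc k) \<beta> G) = ?w k \<alpha> F"
      using decomposes_weight[OF D, of k] by simp
  next
    fix p assume "p \<in> (SIGMA \<beta>:?E. SSAF \<tau>' \<beta>)"
    then obtain \<beta> G where p: "p = (\<beta>, G)" "\<beta> \<in> ?E" "G \<in> SSAF \<tau>' \<beta>" by auto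
    note D = bwd[OF p(2,3)]
    show "(big_shape s \<alpha> (case p of (\<beta>, G) \<Rightarrow> pad s \<alpha> \<beta> G),
        strip s (big_shape s \<alpha> (case p of (\<beta>, G) \<Rightarrow> pad s \<alpha> \<beta> G))
          (case p of (\<beta>, G) \<Rightarrow> pad s \<alpha> \<beta> G)) = p"
      using decomposes_unique(1,2)[OF D] p by (simp add: SSAF_iff_filling)
    show "(case p of (\<beta>, G) \<Rightarrow> pad s \<alpha> \<beta> G) \<in> SSAF \<tau> \<alpha>"
      using iff[OF D] p by (auto simp: SSAF_iff_filling pad_def)
  qed
  also have "\<dots> = (\<Sum>\<beta>\<in>?E. \<Sum>G\<in>SSAF \<tau>' \<beta>.
      X (Suc k) ^ (sum_list \<alpha> - sum_list \<beta>) * ?w (Suc k) \<beta> G)"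
    by (rule sum.Sigma[symmetric]) (simp_all add: finite_extendable finite_SSAF)
  finally show ?thesis by (simp add: shifted_atom_def sum_distrib_left)
qed

subsection \<open>Chains\<close>

lemma reduced_word_Suc: "reduced_word n \<sigma> (Suc k) = delete_one (reduced_word n \<sigma> k)"
  by (simp add: reduced_word_def)

text \<open>Subtracting 1 is injective on entries at least 2, so deleting the 1 and lowering the
  rest again gives the one-line notation of a permutation.\<close>

lemma reduced_word_props:
  assumes "\<sigma> permutes {1..n}" "k \<le> n"
  shows "distinct (reduced_word n \<sigma> k) \<and> set (reduced_word n \<sigma> k) = {1..n - k}"
  using assms(2)
proof (induction k)
  case 0
  have "set (map \<sigma> [1..<n + 1]) = {1..n}"
    using permutes_image[OF assms(1)] by (simp add: atLeastLessThanSuc_atLeastAtMost del: upt_Suc)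
  moreover have "distinct (map \<sigma> [1..<n + 1])"
    using permutes_inj_on[OF assms(1)] by (simp add: distinct_map del: upt_Suc)
  ultimately show ?case by (simp add: reduced_word_def del: upt_Suc)
next
  case (Suc k)
  define w where "w = reduced_word n \<sigma> k"
  have w: "distinct w" "set w = {1..n - k}" using Suc by (simp_all add: w_def)
  have "inj_on (\<lambda>x. x - 1) {x \<in> set w. x \<noteq> 1}"
    unfolding w(2) by (auto simp: inj_on_def)
  then have "distinct (delete_one w)"
    using w(1) by (simp add: delete_one_def distinct_map)
  moreover have "set (delete_one w) = {1..n - Suc k}"
  proof -
    have "set (delete_one w) = (\<lambda>x. x - 1) ` {2..n - k}"
      unfolding delete_one_def using w(2) by (auto simp: image_iff)
    also have "\<dots> = {1..n - Suc k}"
    proof (intro set_eqI iffI)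
      fix x assume "x \<in> {1..n - Suc k}"
      then have "x = Suc x - 1" "Suc x \<in> {2..n - k}" by auto
      then show "x \<in> (\<lambda>x. x - 1) ` {2..n - k}" by blast
    qed auto
    finally show ?thesis .
  qed
  ultimately show ?case by (simp add: reduced_word_Suc w_def)
qed

text \<open>The index on the left is the zero-based form of \<open>skip\<close>, stepping over
  position \<open>p\<close> of the entry 1. Since 0 does not occur, the truncated subtraction in
  \<open>delete_one\<close> is undone by \<open>Suc\<close>.\<close>

lemma nth_delete_one:
  assumes w: "distinct w" "0 \<notin> set w" and s: "p < length w" "w ! p = 1"
    and i: "Suc i < length w"
  shows "w ! (if i < p then i else Suc i) = Suc (delete_one w ! i)"
proof -
  have split: "w = take p w @ 1 # drop (Suc p) w"
    using id_take_nth_drop[OF s(1)] s(2) by simp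
  then have "distinct (take p w @ 1 # drop (Suc p) w)" using w(1) by simp
  then have n1: "1 \<notin> set (take p w)" "1 \<notin> set (drop (Suc p) w)" by simp_all
  define v where "v = take p w @ drop (Suc p) w"
  have "filter (\<lambda>x. x \<noteq> 1) w = filter (\<lambda>x. x \<noteq> 1) (take p w @ 1 # drop (Suc p) w)"
    using split by simp
  also have "\<dots> = v"
  proof -
    have "filter (\<lambda>x. x \<noteq> 1) u = u" if "1 \<notin> set u" for u :: "nat list"
      using that by (induction u) auto
    from this[OF n1(1)] this[OF n1(2)] show ?thesis
      unfolding v_def filter_append by simp
  qed
  finally have del: "delete_one w = map (\<lambda>x. x - 1) v" by (simp add: delete_one_def)
  have len: "i < length v" using s i by (simp add: v_def)
  have v: "v ! i = w ! (if i < p then i else Suc i)"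
    using s i by (simp add: v_def nth_append min_def)
  have "v ! i \<in> set w" unfolding v using i s(1) by (intro nth_mem) simp
  then have "v ! i \<noteq> 0" using w(2) by metis
  then show ?thesis using len by (simp add: del v[symmetric])
qed

text \<open>Supplies the hypotheses of \<open>shifted_atom_rec\<close> for two consecutive reduced
  permutations, with \<open>s\<close> the position of 1 in the first.\<close>

lemma reduced_perm_props:
  assumes "\<sigma> permutes {1..n}" "k < n"
  shows "pos_of_one n \<sigma> k \<in> {1..n - k}"
    and "reduced_perm n \<sigma> k (pos_of_one n \<sigma> k) = 1"
    and "i \<in> {1..<n - k} \<Longrightarrow>
      reduced_perm n \<sigma> k (skip (pos_of_one n \<sigma> k) i) = Suc (reduced_perm n \<sigma> (Suc k) i)"
    and "i \<in> {1..<n - k} \<Longrightarrow> 0 < reduced_perm n \<sigma> (Suc k) i"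
proof -
  define w where "w = reduced_word n \<sigma> k"
  have w: "distinct w" "set w = {1..n - k}"
    using reduced_word_props[OF assms(1), of k] assms(2) by (simp_all add: w_def)
  have len: "length w = n - k" using distinct_card[OF w(1)] w(2) by simp
  have w': "distinct (delete_one w)" "set (delete_one w) = {1..n - Suc k}"
    using reduced_word_props[OF assms(1), of "Suc k"] assms(2)
    by (simp_all add: w_def reduced_word_Suc)
  have len': "length (delete_one w) = n - Suc k" using distinct_card[OF w'(1)] w'(2) by simp
  have \<tau>: "reduced_perm n \<sigma> k = (\<lambda>i. w ! (i - 1))"
    and \<tau>': "reduced_perm n \<sigma> (Suc k) = (\<lambda>i. delete_one w ! (i - 1))"
    by (simp_all add: fun_eq_iff reduced_perm_def w_def reduced_word_Suc)
  have "1 \<in> set w" using w(2) assms(2) by simp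
  then obtain p where "p < length w" "w ! p = 1" by (metis in_set_conv_nth)
  then have "Suc p \<in> {1..n - k}" "reduced_perm n \<sigma> k (Suc p) = 1" by (simp_all add: \<tau> len)
  \<comment> \<open>\<open>inv_into\<close> is guaranteed to give a preimage only for values in the
    image.\<close>
  then have one: "1 \<in> reduced_perm n \<sigma> k ` {1..n - k}" by force
  show pos: "pos_of_one n \<sigma> k \<in> {1..n - k}"
    unfolding pos_of_one_def by (rule inv_into_into[OF one])
  show val: "reduced_perm n \<sigma> k (pos_of_one n \<sigma> k) = 1"
    unfolding pos_of_one_def by (rule f_inv_into_f[OF one])
  show "0 < reduced_perm n \<sigma> (Suc k) i" if "i \<in> {1..<n - k}"
  proof -
    have "delete_one w ! (i - 1) \<in> set (delete_one w)" using that len' by (intro nth_mem) auto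
    then show ?thesis using w'(2) by (simp add: \<tau>')
  qed
  show "reduced_perm n \<sigma> k (skip (pos_of_one n \<sigma> k) i) = Suc (reduced_perm n \<sigma> (Suc k) i)"
    if "i \<in> {1..<n - k}"
  proof -
    define s where "s = pos_of_one n \<sigma> k"
    have s: "s \<in> {1..n - k}" "w ! (s - 1) = 1" using pos val by (simp_all add: s_def \<tau>)
    have "w ! (if i - 1 < s - 1 then i - 1 else Suc (i - 1)) = Suc (delete_one w ! (i - 1))"
      using w s that len by (intro nth_delete_one) auto
    moreover have "skip s i - 1 = (if i - 1 < s - 1 then i - 1 else Suc (i - 1))"
      using that s by (auto simp: skip_def)
    ultimately show ?thesis by (simp add: \<tau> \<tau>' s_def)
  qed
qed

section \<open>Chains, their weights and the induction\<close>

text \<open>The number \<open>m\<close> of steps is separated from \<open>n\<close>, which fixes the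
  covering relation; thus the tail of a chain is again such a chain.\<close>

definition chains_below :: "nat \<Rightarrow> (nat \<Rightarrow> nat) \<Rightarrow> nat \<Rightarrow> nat list \<Rightarrow> nat list list set" where
  "chains_below n \<sigma> m \<alpha> = {\<beta>s. length \<beta>s = m \<and>
     (\<forall>i\<in>{1..m}. covered_by n \<sigma> (chain_elem \<alpha> \<beta>s i) (chain_elem \<alpha> \<beta>s (i - 1)))}"

text \<open>A tail starting after \<open>k\<close> steps of the full chain takes its variables from
  \<open>X (k + 1)\<close> onwards.\<close>

definition chain_weight :: "nat \<Rightarrow> nat list \<Rightarrow> nat list list \<Rightarrow> mpoly" where
  "chain_weight k \<alpha> \<beta>s = (\<Prod>i = 1..length \<beta>s.
     X (k + i) ^ (sum_list (chain_elem \<alpha> \<beta>s (i - 1)) - sum_list (chain_elem \<alpha> \<beta>s i)))"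

lemma chain_elem_Cons:
  "chain_elem \<alpha> (\<beta> # \<beta>s) 0 = \<alpha>" "chain_elem \<alpha> (\<beta> # \<beta>s) (Suc i) = chain_elem \<beta> \<beta>s i"
  by (simp_all add: chain_elem_def)

lemma atLeastAtMost_1_Suc: "{1..Suc m} = insert 1 (Suc ` {1..m})"
  by (auto simp: image_Suc_atLeastAtMost)

lemma chain_weight_Cons:
  "chain_weight k \<alpha> (\<beta> # \<beta>s) =
     X (Suc k) ^ (sum_list \<alpha> - sum_list \<beta>) * chain_weight (Suc k) \<beta> \<beta>s"
proof -
  have "(\<Prod>i\<in>Suc ` {1..length \<beta>s}. X (k + i) ^ (sum_list (chain_elem \<alpha> (\<beta> # \<beta>s) (i - 1)) -
        sum_list (chain_elem \<alpha> (\<beta> # \<beta>s) i))) = chain_weight (Suc k) \<beta> \<beta>s"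
    unfolding chain_weight_def
    by (subst prod.reindex) (auto simp: chain_elem_def nth_Cons' intro!: prod.cong)
  moreover have "chain_elem \<alpha> (\<beta> # \<beta>s) 1 = \<beta>" by (simp add: chain_elem_def)
  moreover have "1 \<notin> Suc ` {1..length \<beta>s}" by auto
  ultimately show ?thesis
    unfolding chain_weight_def[of k] length_Cons atLeastAtMost_1_Suc
    by (simp add: chain_elem_Cons)
qed

lemma Cons_in_chains_below_iff:
  "\<beta> # \<beta>s \<in> chains_below n \<sigma> (Suc m) \<alpha> \<longleftrightarrow>
     covered_by n \<sigma> \<beta> \<alpha> \<and> \<beta>s \<in> chains_below n \<sigma> m \<beta>"
proof -
  have "(\<forall>i\<in>Suc ` {1..m}. covered_by n \<sigma> (chain_elem \<alpha> (\<beta> # \<beta>s) i) (chain_elem \<alpha> (\<beta> # \<beta>s) (i - 1)))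
      \<longleftrightarrow> (\<forall>i\<in>{1..m}. covered_by n \<sigma> (chain_elem \<beta> \<beta>s i) (chain_elem \<beta> \<beta>s (i - 1)))"
    unfolding ball_simps(9) by (intro ball_cong refl) (simp add: chain_elem_def nth_Cons')
  moreover have "chain_elem \<alpha> (\<beta> # \<beta>s) 1 = \<beta>" by (simp add: chain_elem_def)
  ultimately show ?thesis
    unfolding chains_below_def atLeastAtMost_1_Suc by (auto simp: chain_elem_Cons)
qed


text \<open>The length of \<open>\<alpha>\<close> fixes which reduced permutation is used; if the
  lengths do not match, both sides fail because extendability includes equality of lengths.\<close>

lemma covered_by_iff:
  assumes "k < n" "length \<alpha> = n - k"
  shows "covered_by n \<sigma> \<beta> \<alpha> \<longleftrightarrow>
    extendable (reduced_perm n \<sigma> k) (insert_zero (pos_of_one n \<sigma> k) \<beta>) \<alpha>"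
proof (cases "length \<alpha> = Suc (length \<beta>)")
  case True
  then have "length \<beta> < n" "n - length \<beta> - 1 = k" using assms by simp_all
  then show ?thesis using True by (simp add: covered_by_def Let_def)
next
  case False
  then show ?thesis by (simp add: covered_by_def extendable_def)
qed

text \<open>Induction on \<open>k\<close> downwards from \<open>n\<close>, that is, on the length of
  \<open>\<alpha>\<close>, peeling off the first step of each chain. Finiteness is carried along to
  merge the nested sums.\<close>

lemma shifted_atom_eq_sum_chains_below:
  assumes \<sigma>: "\<sigma> permutes {1..n}" and "k \<le> n" "length \<alpha> = n - k"
  shows "finite (chains_below n \<sigma> (n - k) \<alpha>) \<and> shifted_atom k (reduced_perm n \<sigma> k) \<alpha> =
    (\<Sum>\<beta>s\<in>chains_below n \<sigma> (n - k) \<alpha>. chain_weight k \<alpha> \<beta>s)"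
  using assms(2,3)
proof (induction k arbitrary: \<alpha> rule: inc_induct)
  case base
  then have "cells \<alpha> = {}" "nonbasement_cells \<alpha> = {}"
    by (simp_all add: cells_def nonbasement_cells_def)
  \<comment> \<open>The empty shape has one extensional filling, matching the single empty chain;
    both have weight 1.\<close>
  then have "SSAF \<tau> \<alpha> = {\<lambda>_. undefined}" for \<tau>
    using base by (auto simp: SSAF_iff_filling filling_def)
  moreover have "chains_below n \<sigma> 0 \<alpha> = {[]}" by (auto simp: chains_below_def)
  ultimately show ?case
    using \<open>nonbasement_cells \<alpha> = {}\<close> by (simp add: shifted_atom_def chain_weight_def)
next
  case (step k)
  define E where "E = {\<beta>. covered_by n \<sigma> \<beta> \<alpha>}"
  have m: "n - k = Suc (n - Suc k)" using step by simp
  have E: "E = {\<beta>. extendable (reduced_perm n \<sigma> k) (insert_zero (pos_of_one n \<sigma> k) \<beta>) \<alpha>}"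
    unfolding E_def covered_by_iff[OF step.hyps(2) step.prems] ..
  have fin: "finite E" unfolding E by (rule finite_extendable)
  have IH: "finite (chains_below n \<sigma> (n - Suc k) \<beta>)"
      "shifted_atom (Suc k) (reduced_perm n \<sigma> (Suc k)) \<beta> =
        (\<Sum>\<beta>s\<in>chains_below n \<sigma> (n - Suc k) \<beta>. chain_weight (Suc k) \<beta> \<beta>s)"
    if "\<beta> \<in> E" for \<beta>
  proof -
    have "Suc (length \<beta>) = n - k" using that step.prems by (simp add: E_def covered_by_def)
    then have "length \<beta> = n - Suc k" by simp
    then show "finite (chains_below n \<sigma> (n - Suc k) \<beta>)"
      "shifted_atom (Suc k) (reduced_perm n \<sigma> (Suc k)) \<beta> =
        (\<Sum>\<beta>s\<in>chains_below n \<sigma> (n - Suc k) \<beta>. chain_weight (Suc k) \<beta> \<beta>s)"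
      using step.IH by blast+
  qed
  let ?S = "SIGMA \<beta>:E. chains_below n \<sigma> (n - Suc k) \<beta>"
  have chains: "chains_below n \<sigma> (n - k) \<alpha> = (\<lambda>(\<beta>, \<beta>s). \<beta> # \<beta>s) ` ?S"
  proof (intro set_eqI iffI)
    fix \<beta>s assume *: "\<beta>s \<in> chains_below n \<sigma> (n - k) \<alpha>"
    then have "length \<beta>s = Suc (n - Suc k)" unfolding m by (simp add: chains_below_def)
    then obtain \<beta> \<beta>s' where "\<beta>s = \<beta> # \<beta>s'" by (auto simp: length_Suc_conv)
    then show "\<beta>s \<in> (\<lambda>(\<beta>, \<beta>s). \<beta> # \<beta>s) ` ?S"
      using * unfolding m by (auto simp: Cons_in_chains_below_iff E_def image_iff)
  qed (auto simp: m Cons_in_chains_below_iff E_def)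
  have inj: "inj_on (\<lambda>(\<beta>, \<beta>s). \<beta> # \<beta>s) ?S" by (auto simp: inj_on_def)
  have "shifted_atom k (reduced_perm n \<sigma> k) \<alpha> = (\<Sum>\<beta>\<in>E. X (Suc k) ^ (sum_list \<alpha> - sum_list \<beta>) *
      shifted_atom (Suc k) (reduced_perm n \<sigma> (Suc k)) \<beta>)"
    unfolding E using reduced_perm_props[OF \<sigma> step.hyps(2)] step.prems
    by (intro shifted_atom_rec) simp_all
  also have "\<dots> = (\<Sum>\<beta>\<in>E. \<Sum>\<beta>s\<in>chains_below n \<sigma> (n - Suc k) \<beta>. chain_weight k \<alpha> (\<beta> # \<beta>s))"
    by (intro sum.cong refl) (simp add: IH(2) chain_weight_Cons sum_distrib_left)
  also have "\<dots> = (\<Sum>(\<beta>, \<beta>s)\<in>?S. chain_weight k \<alpha> (\<beta> # \<beta>s))"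
    using fin IH(1) by (intro sum.Sigma) simp_all
  also have "\<dots> = (\<Sum>\<beta>s\<in>chains_below n \<sigma> (n - k) \<alpha>. chain_weight k \<alpha> \<beta>s)"
    unfolding chains sum.reindex[OF inj] by (simp add: case_prod_beta comp_def)
  finally have "shifted_atom k (reduced_perm n \<sigma> k) \<alpha> =
    (\<Sum>\<beta>s\<in>chains_below n \<sigma> (n - k) \<alpha>. chain_weight k \<alpha> \<beta>s)" .
  moreover have "finite ?S" by (rule finite_SigmaI[OF fin]) (rule IH(1))
  then have "finite (chains_below n \<sigma> (n - k) \<alpha>)" unfolding chains by (rule finite_imageI)
  ultimately show ?case by blast
qed

theorem corollary3p6:
  fixes n :: nat and \<sigma> :: "nat \<Rightarrow> nat" and \<alpha> :: "nat list"
  assumes "n \<ge> 1"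
    and "\<sigma> permutes {1..n}"
    and "length \<alpha> = n"
  shows "atom \<sigma> \<alpha> =
    (\<Sum>\<beta>s\<in>saturated_chains n \<sigma> \<alpha>. \<Prod>i = 1..n.
       X i ^ (sum_list (chain_elem \<alpha> \<beta>s (i - 1)) - sum_list (chain_elem \<alpha> \<beta>s i)))"
proof -
  \<comment> \<open>Agreement on \<open>{1..n}\<close> suffices, since an SSAF of shape
    \<open>\<alpha>\<close> reads the basement only at these indices.\<close>
  have "reduced_perm n \<sigma> 0 i = \<sigma> i" if "i \<in> {1..n}" for i
  proof -
    have "map \<sigma> [1..<n + 1] ! (i - 1) = \<sigma> (1 + (i - 1))"
      using that by (intro nth_map_upt) auto
    then show ?thesis using that by (simp add: reduced_perm_def reduced_word_def del: upt_Suc)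
  qed
  then have "SSAF (reduced_perm n \<sigma> 0) \<alpha> = SSAF \<sigma> \<alpha>"
    using assms(3) by (auto simp: SSAF_iff_filling filling_def)
  then have "atom \<sigma> \<alpha> = shifted_atom 0 (reduced_perm n \<sigma> 0) \<alpha>"
    by (simp add: atom_def shifted_atom_def)
  also have "\<dots> = (\<Sum>\<beta>s\<in>chains_below n \<sigma> n \<alpha>. chain_weight 0 \<alpha> \<beta>s)"
    using shifted_atom_eq_sum_chains_below[OF assms(2), of 0 \<alpha>] assms(3) by simp
  also have "chains_below n \<sigma> n \<alpha> = saturated_chains n \<sigma> \<alpha>"
    by (simp add: chains_below_def saturated_chains_def)
  finally show ?thesis
    by (simp add: chain_weight_def saturated_chains_def)
qed

end
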